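(* Let $G$ be a metrizable topological group, let $d$ be a right-invariant compatible metric on $G$, and let $(K_n)_{n\in\mathbb{N}}$ be an ascending chain of compact subgroups of $G$ such that $G=\overline{\bigcup_{n\in\mathbb{N}}K_n}$. For each $n\in\mathbb{N}$, let $d_n$ be the restriction of $d$ to $K_n$ and let $\mu_n$ be the normalized Haar measure on $K_n$. If $G$ admits an open subgroup of infinite index, then the sequence of $mm$-spaces $(K_n,d_n,\mu_n)_{n\in\mathbb{N}}$ dissipates, and thus fails to have a $d_{\mathrm{conc}}$-Cauchy subsequence.
   Context: A compatible metric on a metrizable space is a metric generating its topology. An $mm$-space is a triple $\mathcal{X}=(X,d,\mu)$ where $(X,d)$ is a separable complete metric space and $\mu$ is a Borel probability measure on $X$. For $m\in\mathbb{N}\setminus\{0\}$ and $\kappa_0,\ldots,\kappa_m>0$, the separation distance $\mathrm{Sep}(\mathcal{X};\kappa_0,\ldots,\kappa_m)$ is the supremum, over all tuples $(B_0,\ldots,B_m)$ of Borel subsets of $X$ with $\mu(B_i)\ge\kappa_i$ for each $i$, of $\inf\{d(x,y)\mid i,j\in\{0,\ldots,m\},\ i\ne j,\ x\in B_i,\ y\in B_j\}$ (infima and suprema taken in $[0,\infty)$, so the supremum of the empty set is $0$). For $\delta>0$, a sequence of $mm$-spaces $(\mathcal{X}_n)_{n\in\mathbb{N}}$ $\delta$-dissipates if $\liminf_{n\to\infty}\mathrm{Sep}(\mathcal{X}_n;\kappa_0,\ldots,\kappa_m)\ge\delta$ for all $m\in\mathbb{N}\setminus\{0\}$ and all $\kappa_0,\ldots,\kappa_m>0$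 with $\sum_{i=0}^m\kappa_i<1$. It dissipates if it $\delta$-dissipates for some $\delta>0$. Let $\lambda$ be Lebesgue measure on $[0,1]$. For a probability measure $\mu$ and measurable real-valued $f,g$, put $\mathrm{me}_\mu(f,g)=\inf\{\epsilon>0\mid\mu(\{x\mid|f(x)-g(x)|>\epsilon\})\le\epsilon\}$. A parametrization of $\mathcal{X}$ is a Borel map $\phi\colon[0,1]\to X$ with $\phi_*(\lambda)=\mu$; every $mm$-space admits one. $\mathrm{Lip}_1(\mathcal{X})$ denotes the set of $1$-Lipschitz real-valued functions on $(X,d)$, and $\mathrm{Lip}_1(\mathcal{X})\circ\phi=\{f\circ\phi\mid f\in\mathrm{Lip}_1(\mathcal{X})\}$. The observable distance is $$d_{\mathrm{conc}}(\mathcal{X},\mathcal{Y})=\inf\{\mathrm{H}_{\mathrm{me}_\lambda}(\mathrm{Lip}_1(\mathcal{X})\circ\phi,\mathrm{Lip}_1(\mathcal{Y})\circ\psi)\mid\phi\text{ parametrization of }\mathcal{X},\ \psi\text{ parametrization of }\mathcal{Y}\},$$ where $\mathrm{H}_{\mathrm{me}_\lambda}$ is the Hausdorff distance with respect to the pseudo-metric $\mathrm{me}_\lambda$: $\mathrm{H}_{\mathrm{me}_\lambda}(A,B)$ is the infimum of all $\epsilon>0$ such that each element of $A$ is at distance $<\epsilon$ from some element of $B$ and vice versa. *)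

theory Defs
  imports "HOL-Probability.Probability_Measure" "HOL-Algebra.Coset"
begin

section \<open>Topological groups and Haar measure\<close>

locale topological_group = group +
  fixes T :: "'a topology"
  assumes topspace_eq: "topspace T = carrier G"
    and continuous_mult: "continuous_map (prod_topology T T) T (\<lambda>(x, y). x \<otimes> y)"
    and continuous_inv: "continuous_map T T (\<lambda>x. inv x)"

definition right_invariant_metric :: "('a, 'b) monoid_scheme \<Rightarrow> 'a metric \<Rightarrow> bool" where
  "right_invariant_metric G d \<longleftrightarrow>
     (\<forall>x\<in>carrier G. \<forall>y\<in>carrier G. \<forall>z\<in>carrier G.
        mdist d (x \<otimes>\<^bsub>G\<^esub> z) (y \<otimes>\<^bsub>G\<^esub> z) = mdist d x y)"

definition borel_of :: "'a topology \<Rightarrow> 'a measure" where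
  "borel_of T = sigma (topspace T) {U. openin T U}"

text \<open>
  For a compact Hausdorff group there is exactly one left-invariant Radon probability measure, so
  this predicate determines the measure. On a compact metrizable group the inner regularity clause
  is automatic.
\<close>

definition normalized_Haar_measure ::
    "('a, 'b) monoid_scheme \<Rightarrow> 'a topology \<Rightarrow> 'a measure \<Rightarrow> bool" where
  "normalized_Haar_measure G T M \<longleftrightarrow>
     prob_space M \<and> space M = topspace T \<and> sets M = sets (borel_of T) \<and>
     (\<forall>g\<in>carrier G. \<forall>A\<in>sets M. emeasure M (g <#\<^bsub>G\<^esub> A) = emeasure M A) \<and>
     (\<forall>A\<in>sets M. emeasure M A = (SUP C\<in>{C \<in> sets M. compactin T C \<and> C \<subseteq> A}. emeasure M C))"

section \<open>Metric measure spaces\<close>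

text \<open>
  A triple $(X,d,\mu)$ is encoded as a pair, since the type \<^typ>\<open>'a metric\<close> carries its
  underlying set \<^term>\<open>mspace d\<close>.
\<close>

type_synonym 'a mm = "'a metric \<times> 'a measure"

definition mm_space :: "'a mm \<Rightarrow> bool" where
  "mm_space = (\<lambda>(d, M).
     separable_space (mtopology_of d) \<and> mcomplete_of d \<and>
     prob_space M \<and> space M = mspace d \<and> sets M = sets (borel_of (mtopology_of d)))"

text \<open>
  Infima and suprema are formed in \<^typ>\<open>ennreal\<close>, where the supremum of the empty set is 0.
  Only \<open>\<kappa> 0, \<dots>, \<kappa> m\<close> and \<open>B 0, \<dots>, B m\<close> matter. On an mm-space, for \<open>m \<ge> 1\<close> and positive
  \<open>\<kappa> i\<close>, the sets \<open>B i\<close> are nonempty and the value is finite.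
\<close>

definition Sep :: "'a mm \<Rightarrow> nat \<Rightarrow> (nat \<Rightarrow> real) \<Rightarrow> ennreal" where
  "Sep = (\<lambda>(d, M) m \<kappa>.
     (SUP B \<in> {B. \<forall>i\<le>m. B i \<in> sets M \<and> measure M (B i) \<ge> \<kappa> i}.
       Inf {ennreal (mdist d x y) | i j x y. i \<le> m \<and> j \<le> m \<and> i \<noteq> j \<and> x \<in> B i \<and> y \<in> B j}))"

definition delta_dissipates :: "real \<Rightarrow> (nat \<Rightarrow> 'a mm) \<Rightarrow> bool" where
  "delta_dissipates \<delta> X \<longleftrightarrow>
     (\<forall>m \<kappa>. m \<noteq> 0 \<longrightarrow> (\<forall>i\<le>m. \<kappa> i > 0) \<longrightarrow> (\<Sum>i\<le>m. \<kappa> i) < 1 \<longrightarrow>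
        liminf (\<lambda>n. Sep (X n) m \<kappa>) \<ge> ennreal \<delta>)"

definition dissipates :: "(nat \<Rightarrow> 'a mm) \<Rightarrow> bool" where
  "dissipates X \<longleftrightarrow> (\<exists>\<delta>>0. delta_dissipates \<delta> X)"

section \<open>Observable distance\<close>

definition me :: "'a measure \<Rightarrow> ('a \<Rightarrow> real) \<Rightarrow> ('a \<Rightarrow> real) \<Rightarrow> real" where
  "me M f g = Inf {\<epsilon>. \<epsilon> > 0 \<and> measure M {x \<in> space M. \<bar>f x - g x\<bar> > \<epsilon>} \<le> \<epsilon>}"

definition Hausdorff_distance :: "('a \<Rightarrow> 'a \<Rightarrow> real) \<Rightarrow> 'a set \<Rightarrow> 'a set \<Rightarrow> ennreal" where
  "Hausdorff_distance \<rho> A B =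
     Inf {ennreal \<epsilon> | \<epsilon>. \<epsilon> > 0 \<and> (\<forall>a\<in>A. \<exists>b\<in>B. \<rho> a b < \<epsilon>) \<and> (\<forall>b\<in>B. \<exists>a\<in>A. \<rho> b a < \<epsilon>)}"

definition unit_interval_measure :: "real measure" where
  "unit_interval_measure = restrict_space lborel {0..1}"

definition parametrization :: "'a mm \<Rightarrow> (real \<Rightarrow> 'a) \<Rightarrow> bool" where
  "parametrization = (\<lambda>(d, M) \<phi>.
     \<phi> \<in> measurable unit_interval_measure M \<and> distr unit_interval_measure M \<phi> = M)"

text \<open>The values of these functions outside \<^term>\<open>mspace d\<close> are unconstrained and play no role.\<close>

definition Lip1 :: "'a mm \<Rightarrow> ('a \<Rightarrow> real) set" where
  "Lip1 = (\<lambda>(d, M). {f. \<forall>x\<in>mspace d. \<forall>y\<in>mspace d. \<bar>f x - f y\<bar> \<le> mdist d x y})"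

definition d_conc :: "'a mm \<Rightarrow> 'b mm \<Rightarrow> ennreal" where
  "d_conc X Y =
     Inf {Hausdorff_distance (me unit_interval_measure)
            ((\<lambda>f. f \<circ> \<phi>) ` Lip1 X) ((\<lambda>g. g \<circ> \<psi>) ` Lip1 Y) | \<phi> \<psi>.
          parametrization X \<phi> \<and> parametrization Y \<psi>}"

definition d_conc_Cauchy :: "(nat \<Rightarrow> 'a mm) \<Rightarrow> bool" where
  "d_conc_Cauchy X \<longleftrightarrow>
     (\<forall>\<epsilon>>0. \<exists>N. \<forall>m\<ge>N. \<forall>n\<ge>N. d_conc (X m) (X n) < ennreal \<epsilon>)"

end

theory Submission
  imports Defs
begin

text \<open>
  Two facts about the open subgroup $H$ of infinite index drive the proof. By right-invariance of
  $d$, a ball of radius $\delta$ around the identity that lies in $H$ keeps distinct right cosets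
  of $H$ at distance at least $\delta$ from one another (\<open>rcosets_separated\<close>). Moreover, every
  right coset of $H$ is open and hence meets the dense union of the $K_n$, so that the index $N_n$
  of $H \cap K_n$ in $K_n$, which is finite by compactness, tends to infinity
  (\<open>index_in_dense_chain_tendsto_infinity\<close>). In $K_n$ the $N_n$ cosets of $H \cap K_n$ all have
  measure $1/N_n$ (\<open>Haar_measure_rcoset\<close>). Thus $K_n$ consists of many pieces that are equally
  small and uniformly separated, and grouping these pieces approximates any prescribed weights
  $\kappa_0, \dots, \kappa_m$ of sum less than 1 (\<open>Sep_Haar_measure_lower_bound\<close>). This is
  $\delta$-dissipation.

  That a dissipating sequence of mm-spaces is not Cauchy for the observable distance is a
  contest between two complexities. Up to small measure, up to additive constants and up to a small
  error, the 1-Lipschitz functions on a fixed mm-space $Y$ fall into finitely many classes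
  (\<open>finitely_many_balls_almost_cover\<close> and \<open>Lip1_pigeonhole\<close>). On a space $X$ far out in the
  dissipating sequence, however, there are arbitrarily many 1-Lipschitz functions that are mutually
  far apart, even modulo constants. Given $2^P$ well separated sets $B_A$, indexed by the subsets
  $A$ of $\{0, \dots, P-1\}$, let $g_j$ vanish on the $B_A$ with $j \in A$ and take the value
  $\delta$ on the others. These functions behave like the coordinates of a discrete cube: for
  $j \ne l$ the difference $g_j - g_l$ takes both values $\delta$ and $-\delta$ with probability
  bounded away from 0. If $X$ and $Y$ were close, then the $g_j$ would be matched by functions on
  $Y$, two of which fall into one class as soon as $P$ exceeds the number of classes, a
  contradiction (\<open>d_conc_lower_bound\<close>).
\<close>

section \<open>Lipschitz functions on mm-spaces\<close>

lemma openin_imp_borel_of: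
  assumes "openin T U"
  shows "U \<in> sets (borel_of T)"
proof -
  have "{U. openin T U} \<subseteq> Pow (topspace T)" using openin_subset by blast
  with assms show ?thesis unfolding borel_of_def by (simp add: sets_measure_of)
qed

lemma open_in_mm_space_measurable:
  assumes "mm_space (d, M)" and "openin (mtopology_of d) U"
  shows "U \<in> sets M"
  using assms openin_imp_borel_of by (auto simp: mm_space_def)

lemma Lip1_measurable:
  assumes "mm_space (d, M)" and "f \<in> Lip1 (d, M)"
  shows "f \<in> borel_measurable M"
proof (rule borel_measurableI)
  fix S :: "real set"
  assume "open S"
  have [simp]: "space M = mspace d" using assms(1) by (auto simp: mm_space_def)
  interpret Metric_space "mspace d" "mdist d" by simp
  have "openin (mtopology_of d) (f -` S \<inter> mspace d)"
    unfolding mtopology_of_def openin_mtopology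
  proof (intro conjI allI impI)
    show "f -` S \<inter> mspace d \<subseteq> mspace d" by simp
    fix x assume x: "x \<in> f -` S \<inter> mspace d"
    then obtain e where e: "e > 0" "\<And>z. dist z (f x) < e \<Longrightarrow> z \<in> S"
      using \<open>open S\<close> by (auto simp: open_dist)
    have "mball x e \<subseteq> f -` S \<inter> mspace d"
    proof
      fix y assume y: "y \<in> mball x e"
      with assms(2) x have "\<bar>f y - f x\<bar> \<le> mdist d y x" by (auto simp: Lip1_def)
      with y have "dist (f y) (f x) < e" by (simp add: dist_real_def commute)
      then show "y \<in> f -` S \<inter> mspace d" using y e(2) by auto
    qed
    then show "\<exists>r>0. mball x r \<subseteq> f -` S \<inter> mspace d" using e(1) by blast
  qed
  then show "f -` S \<inter> space M \<in> sets M"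
    using open_in_mm_space_measurable[OF assms(1)] by simp
qed

lemma openin_mball_of: "openin (mtopology_of d) (mball_of d x r)"
  by (simp add: Metric_space.openin_mball mball_of_def mtopology_of_def)

text \<open>
  The countably many balls around the points of a dense set cover the space, so continuity of the
  measure from below leaves only a small set outside finitely many of them. This replaces
  compactness in the finiteness argument for Lipschitz functions.
\<close>

lemma finitely_many_balls_almost_cover:
  assumes mm: "mm_space (d, M)" and "\<epsilon> > 0"
  shows "\<exists>F. finite F \<and> F \<subseteq> mspace d \<and> measure M (\<Union>x\<in>F. mball_of d x \<epsilon>) > 1 - \<epsilon>"
proof -
  have [simp]: "space M = mspace d" and prob: "prob_space M"
    and sep: "separable_space (mtopology_of d)"
    using mm by (auto simp: mm_space_def)
  interpret prob_space M by fact
  obtain C where C: "countable C" "C \<subseteq> mspace d" "mtopology_of d closure_of C = mspace d"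
    using sep by (auto simp: separable_space_def)
  have "C \<noteq> {}" using C(3) not_empty by auto
  define c where "c = from_nat_into C"
  have c: "range c = C" unfolding c_def using \<open>C \<noteq> {}\<close> C(1) by (rule range_from_nat_into)
  define A where "A n = (\<Union>i\<le>n. mball_of d (c i) \<epsilon>)" for n
  have "A n \<in> sets M" for n
    unfolding A_def
    by (intro sets.finite_UN open_in_mm_space_measurable[OF mm] openin_mball_of) simp
  then have A: "range A \<subseteq> sets M" by blast
  have inc: "incseq A"
    unfolding A_def by (intro monoI UN_mono) auto
  have "(\<Union>n. A n) = mspace d"
  proof
    show "mspace d \<subseteq> (\<Union>n. A n)"
    proof
      fix x assume x: "x \<in> mspace d"
      then have "x \<in> mtopology_of d closure_of C" using C by simp
      then obtain y where y: "y \<in> C" "y \<in> mball_of d x \<epsilon>"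
        using x \<open>\<epsilon> > 0\<close> openin_mball_of[of d x \<epsilon>] Metric_space.mdist_zero[of "mspace d" "mdist d" x]
        unfolding in_closure_of by (metis Metric_space_mspace_mdist in_mball_of)
      then obtain n where "y = c n" using c by auto
      then show "x \<in> (\<Union>n. A n)"
        using y x by (auto simp: A_def mdist_commute)
    qed
  qed (auto simp: A_def)
  with finite_Lim_measure_incseq[OF A inc] have "(\<lambda>n. measure M (A n)) \<longlonglongrightarrow> 1"
    using prob_space by simp
  then have "\<forall>\<^sub>F n in sequentially. measure M (A n) > 1 - \<epsilon>"
    by (rule order_tendstoD) (use \<open>\<epsilon> > 0\<close> in simp)
  then obtain n where "measure M (A n) > 1 - \<epsilon>" by (auto dest: eventually_happens)
  then show ?thesis
    using c C(2) by (intro exI[of _ "c ` {..n}"]) (auto simp: A_def)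
qed

text \<open>
  A 1-Lipschitz function normalized to vanish at a point of \<open>F\<close> is bounded on \<open>F\<close> by the distances
  to that point. Rounding its values on \<open>F\<close> to multiples of \<open>\<epsilon>\<close> therefore leaves only finitely many
  possibilities, and among sufficiently many functions two are rounded alike. The normalization
  accounts for the constant \<open>c\<close>; the factor 3 adds the rounding error and the variation of both
  functions from a centre in \<open>F\<close> to a point of its ball.
\<close>

lemma Lip1_pigeonhole:
  assumes "finite F" and "F \<subseteq> mspace d" and "\<epsilon> > 0"
  obtains P where "P \<ge> 2"
    and "\<And>f :: nat \<Rightarrow> 'a \<Rightarrow> real. (\<And>j. j < P \<Longrightarrow> f j \<in> Lip1 (d, M)) \<Longrightarrow>
           \<exists>j<P. \<exists>l<P. j \<noteq> l \<and> (\<exists>c. \<forall>y\<in>(\<Union>x\<in>F. mball_of d x \<epsilon>). \<bar>f j y - f l y - c\<bar> \<le> 3 * \<epsilon>)"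
proof (cases "F = {}")
  case True
  show ?thesis
  proof (rule that[of 2])
    show "\<exists>j<2. \<exists>l<2. j \<noteq> l \<and> (\<exists>c. \<forall>y\<in>(\<Union>x\<in>F. mball_of d x \<epsilon>). \<bar>f j y - f l y - c\<bar> \<le> 3 * \<epsilon>)"
      for f :: "nat \<Rightarrow> 'a \<Rightarrow> real"
      by (rule exI[of _ 0], simp, rule exI[of _ 1]) (simp add: True)
  qed simp
next
  case False
  then obtain x0 where x0: "x0 \<in> F" by blast
  \<comment> \<open>The sum merely serves as a common bound for the distances from points of \<open>F\<close> to \<open>x0\<close>.\<close>
  define k where "k = \<lceil>(\<Sum>x\<in>F. mdist d x x0) / \<epsilon>\<rceil> + 1"
  define P where "P = card (F \<rightarrow>\<^sub>E {-k..k}) + 2"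
  show ?thesis
  proof (rule that[of P])
    fix f :: "nat \<Rightarrow> 'a \<Rightarrow> real"
    assume f: "\<And>j. j < P \<Longrightarrow> f j \<in> Lip1 (d, M)"
    define b where "b j = (\<lambda>x\<in>F. \<lfloor>(f j x - f j x0) / \<epsilon>\<rfloor>)" for j
    have "b j \<in> F \<rightarrow>\<^sub>E {-k..k}" if j: "j < P" for j
    proof -
      have "\<lfloor>(f j x - f j x0) / \<epsilon>\<rfloor> \<in> {-k..k}" if x: "x \<in> F" for x
      proof -
        have "\<bar>f j x - f j x0\<bar> \<le> mdist d x x0"
          using f[OF j] x x0 assms(2) by (auto simp: Lip1_def)
        also have "\<dots> \<le> (\<Sum>x\<in>F. mdist d x x0)"
          using x assms(1) by (intro member_le_sum) auto
        finally have "\<bar>(f j x - f j x0) / \<epsilon>\<bar> \<le> (\<Sum>x\<in>F. mdist d x x0) / \<epsilon>"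
          using assms(3) by (simp add: divide_right_mono)
        then have "of_int (- k) \<le> (f j x - f j x0) / \<epsilon>" "(f j x - f j x0) / \<epsilon> < of_int k + 1"
          using le_of_int_ceiling[of "(\<Sum>x\<in>F. mdist d x x0) / \<epsilon>"] unfolding k_def by linarith+
        then show ?thesis by (simp add: le_floor_iff floor_le_iff)
      qed
      then show ?thesis by (auto simp: b_def)
    qed
    then have "b ` {..<P} \<subseteq> F \<rightarrow>\<^sub>E {-k..k}" by blast
    then have "card (b ` {..<P}) \<le> card (F \<rightarrow>\<^sub>E {-k..k})"
      using assms(1) by (intro card_mono finite_PiE) auto
    then have "\<not> inj_on b {..<P}" by (intro pigeonhole) (simp add: P_def)
    then obtain j l where jl: "j < P" "l < P" "j \<noteq> l" "b j = b l" by (auto simp: inj_on_def)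
    have "\<bar>f j y - f l y - (f j x0 - f l x0)\<bar> \<le> 3 * \<epsilon>"
      if y: "y \<in> (\<Union>x\<in>F. mball_of d x \<epsilon>)" for y
    proof -
      from y obtain x where x: "x \<in> F" "y \<in> mspace d" "mdist d x y < \<epsilon>" "x \<in> mspace d" by auto
      have fl: "\<lfloor>(f j x - f j x0) / \<epsilon>\<rfloor> = \<lfloor>(f l x - f l x0) / \<epsilon>\<rfloor>"
        using jl(4) x(1) by (auto simp: b_def dest: fun_cong[of _ _ x])
      have "\<bar>(f j x - f j x0) / \<epsilon> - (f l x - f l x0) / \<epsilon>\<bar> < 1" using fl by linarith
      then have "\<bar>(f j x - f j x0) - (f l x - f l x0)\<bar> < \<epsilon>"
        using assms(3) by (simp add: diff_divide_distrib[symmetric])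
      moreover have "\<bar>f j x - f j y\<bar> \<le> mdist d x y" "\<bar>f l x - f l y\<bar> \<le> mdist d x y"
        using f jl x by (auto simp: Lip1_def)
      ultimately show ?thesis using x(3) by linarith
    qed
    then show "\<exists>j<P. \<exists>l<P. j \<noteq> l \<and>
        (\<exists>c. \<forall>y\<in>(\<Union>x\<in>F. mball_of d x \<epsilon>). \<bar>f j y - f l y - c\<bar> \<le> 3 * \<epsilon>)"
      using jl by blast
  qed (simp add: P_def)
qed

text \<open>
  The distance to \<open>U\<close>, capped at \<open>\<delta>\<close>.
\<close>

lemma Lip1_separating:
  assumes "U \<subseteq> mspace d" and "U \<noteq> {}" and "\<delta> \<ge> 0"
  obtains f where "f \<in> Lip1 (d, M)" and "\<And>x. x \<in> U \<Longrightarrow> f x = 0"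
    and "\<And>x. x \<in> mspace d \<Longrightarrow> (\<And>u. u \<in> U \<Longrightarrow> \<delta> \<le> mdist d u x) \<Longrightarrow> f x = \<delta>"
proof -
  define r where "r x = (INF u\<in>U. mdist d u x)" for x
  have bdd: "bdd_below ((\<lambda>u. mdist d u x) ` U)" for x by (rule bdd_belowI[of _ 0]) auto
  have r_le: "r x \<le> r y + mdist d x y" if "x \<in> mspace d" "y \<in> mspace d" for x y
  proof -
    have "r x - mdist d x y \<le> r y"
      unfolding r_def[of y]
    proof (rule cINF_greatest[OF assms(2)])
      fix u assume u: "u \<in> U"
      have "r x \<le> mdist d u x" unfolding r_def using bdd u by (rule cINF_lower)
      also have "\<dots> \<le> mdist d u y + mdist d y x"
        using u assms(1) that by (intro mdist_triangle) auto
      finally show "r x - mdist d x y \<le> mdist d u y" by (simp add: mdist_commute)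
    qed
    then show ?thesis by simp
  qed
  show ?thesis
  proof (rule that[of "\<lambda>x. min \<delta> (r x)"])
    show "(\<lambda>x. min \<delta> (r x)) \<in> Lip1 (d, M)"
      using r_le by (fastforce simp: Lip1_def mdist_commute min_def abs_if)
    fix x
    show "min \<delta> (r x) = 0" if "x \<in> U"
    proof -
      have "r x \<le> mdist d x x" unfolding r_def using bdd that by (rule cINF_lower)
      moreover have "mdist d x x = 0" using that assms(1) by auto
      moreover have "0 \<le> r x" unfolding r_def using assms(2) by (intro cINF_greatest) auto
      ultimately show ?thesis using assms(3) by simp
    qed
    show "min \<delta> (r x) = \<delta>" if "\<And>u. u \<in> U \<Longrightarrow> \<delta> \<le> mdist d u x"
      using cINF_greatest[OF assms(2) that] by (simp add: r_def)
  qed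
qed

section \<open>Dissipation excludes Cauchy sequences\<close>

text \<open>
  The infimum that defines \<^const>\<open>me\<close> need not be used exactly: any admissible value below \<open>\<epsilon>\<close> makes
  \<open>\<epsilon>\<close> itself admissible, by monotonicity. The set of admissible values contains 1, so it is nonempty.
\<close>

lemma me_less_imp:
  assumes "prob_space N" and [measurable]: "f \<in> borel_measurable N" "g \<in> borel_measurable N"
    and "me N f g < \<epsilon>"
  shows "measure N {x \<in> space N. \<bar>f x - g x\<bar> > \<epsilon>} \<le> \<epsilon>"
proof -
  interpret prob_space N by fact
  let ?E = "{\<epsilon>. \<epsilon> > 0 \<and> measure N {x \<in> space N. \<bar>f x - g x\<bar> > \<epsilon>} \<le> \<epsilon>}"
  have "1 \<in> ?E" by simp
  then obtain e where e: "e \<in> ?E" "e < \<epsilon>"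
    using cInf_lessD[of ?E \<epsilon>] assms(4) unfolding me_def by blast
  have "measure N {x \<in> space N. \<bar>f x - g x\<bar> > \<epsilon>} \<le> measure N {x \<in> space N. \<bar>f x - g x\<bar> > e}"
    using e(2) by (intro finite_measure_mono) auto
  with e show ?thesis by auto
qed

lemma prob_space_unit_interval: "prob_space unit_interval_measure"
  unfolding unit_interval_measure_def
  by (rule prob_spaceI) (simp add: emeasure_restrict_space space_restrict_space)

lemma parametrization_measure:
  assumes "parametrization (d, M) \<phi>" and "B \<in> sets M"
  shows "measure unit_interval_measure (\<phi> -` B \<inter> space unit_interval_measure) = measure M B"
  using assms by (metis (mono_tags, lifting) case_prod_conv measure_distr parametrization_def)

text \<open>
  A quarter of all subsets contain \<open>j\<close> and miss \<open>l\<close>, since the two memberships can be chosen freely.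
\<close>

lemma card_subsets_separating:
  assumes "j < P" and "l < P" and "j \<noteq> l"
  shows "4 * card {A \<in> Pow {..<P}. j \<in> A \<and> l \<notin> A} = 2 ^ P"
proof -
  have "{A \<in> Pow {..<P}. j \<in> A \<and> l \<notin> A} = insert j ` Pow ({..<P} - {j, l})"
  proof (intro equalityI subsetI)
    fix A assume "A \<in> {A \<in> Pow {..<P}. j \<in> A \<and> l \<notin> A}"
    then show "A \<in> insert j ` Pow ({..<P} - {j, l})"
      by (intro image_eqI[of _ _ "A - {j}"]) auto
  qed (use assms in auto)
  moreover have "inj_on (insert j) (Pow ({..<P} - {j, l}))"
    by (auto simp: inj_on_def)
  moreover have "card (Pow ({..<P} - {j, l})) = 2 ^ (P - 2)"
    using assms by (simp add: card_Pow card_Diff_subset)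
  ultimately have "card {A \<in> Pow {..<P}. j \<in> A \<and> l \<notin> A} = 2 ^ (P - 2)"
    by (simp add: card_image)
  moreover have "(2::nat) ^ P = 4 * 2 ^ (P - 2)"
    using assms by (cases P; cases "P - 1") auto
  ultimately show ?thesis by simp
qed

text \<open>
  Dissipation applied with equal weights whose sum is only \<open>1 / 2\<close>. Passing to a smaller \<open>\<delta>'\<close> makes up
  for the supremum in \<^const>\<open>Sep\<close>, which need not be attained.
\<close>

lemma delta_dissipates_separated_sets:
  assumes "delta_dissipates \<delta> X" and "0 \<le> \<delta>'" and "\<delta>' < \<delta>" and "finite I" and "card I \<ge> 2"
  shows "\<forall>\<^sub>F n in sequentially. \<exists>B.
           (\<forall>i\<in>I. B i \<in> sets (snd (X n)) \<and> measure (snd (X n)) (B i) \<ge> 1 / (2 * card I)) \<and>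
           (\<forall>i\<in>I. \<forall>j\<in>I. i \<noteq> j \<longrightarrow> (\<forall>x\<in>B i. \<forall>y\<in>B j. \<delta>' < mdist (fst (X n)) x y))"
proof -
  define m where "m = card I - 1"
  define \<kappa> where "\<kappa> = (\<lambda>i::nat. 1 / (2 * real (card I)))"
  obtain h where h: "bij_betw h I {0..<card I}"
    using ex_bij_betw_finite_nat[OF assms(4)] by blast
  have h_le: "h i \<le> m" if "i \<in> I" for i
    using bij_betw_apply[OF h that] by (simp add: m_def)
  have "(\<Sum>i\<le>m. \<kappa> i) = 1 / 2" using assms(5) by (simp add: \<kappa>_def m_def)
  then have "ennreal \<delta> \<le> liminf (\<lambda>n. Sep (X n) m \<kappa>)"
    using assms(1,5) by (auto simp: delta_dissipates_def m_def \<kappa>_def)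
  moreover have "ennreal \<delta>' < ennreal \<delta>" using assms(2,3) by (simp add: ennreal_less_iff)
  ultimately have "\<forall>\<^sub>F n in sequentially. ennreal \<delta>' < Sep (X n) m \<kappa>"
    unfolding le_Liminf_iff by blast
  then show ?thesis
  proof eventually_elim
    case (elim n)
    obtain d M where X: "X n = (d, M)" by force
    from elim obtain B where B: "\<And>i. i \<le> m \<Longrightarrow> B i \<in> sets M \<and> measure M (B i) \<ge> \<kappa> i"
      and Inf: "ennreal \<delta>' <
        Inf {ennreal (mdist d x y) | i j x y. i \<le> m \<and> j \<le> m \<and> i \<noteq> j \<and> x \<in> B i \<and> y \<in> B j}"
      unfolding Sep_def X case_prod_conv less_SUP_iff by blast
    have sep: "\<delta>' < mdist d x y"
      if "i \<le> m" "j \<le> m" "i \<noteq> j" "x \<in> B i" "y \<in> B j" for i j x y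
    proof -
      have "ennreal \<delta>' < ennreal (mdist d x y)"
        by (rule less_le_trans[OF Inf]) (use that in \<open>auto intro!: Inf_lower\<close>)
      then show ?thesis using assms(2) by (simp add: ennreal_less_iff)
    qed
    have "\<delta>' < mdist d x y"
      if "i \<in> I" "j \<in> I" "i \<noteq> j" "x \<in> B (h i)" "y \<in> B (h j)" for i j x y
      using sep[OF h_le h_le _ that(4,5)] that h by (metis bij_betw_def inj_on_def)
    then show ?case
      using B h_le by (intro exI[of _ "B \<circ> h"]) (auto simp: X \<kappa>_def)
  qed
qed

text \<open>
  The quantitative core. Suppose that parametrizations of both spaces witness a distance below
  \<open>\<epsilon>\<close>. The cube-like functions \<open>g j\<close> on \<open>X\<close> are then matched by functions \<open>f j\<close> on \<open>Y\<close>, and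
  by the pigeonhole hypothesis some \<open>f j - f l\<close> is nearly constant on \<open>V\<close>. Outside an exceptional set
  of measure at most \<open>3 * \<epsilon>\<close> (\<open>E j\<close> and \<open>E l\<close>, where the matching is bad, and the preimage \<open>Z\<close> of the
  complement of \<open>V\<close>) the difference \<open>g j - g l\<close> is within \<open>3 * \<epsilon> + 2 * \<epsilon>\<close> of a constant \<open>c\<close>. But the
  values \<open>\<delta>\<close> and \<open>- \<delta>\<close> are each taken with probability at least \<open>1 / 8\<close>, hence also outside the
  exceptional set because \<open>3 * \<epsilon> < 1 / 8\<close>; and \<open>c\<close> cannot be within \<open>5 * \<epsilon> < \<delta>\<close> of both.
\<close>

lemma d_conc_lower_bound:
  fixes B :: "nat set \<Rightarrow> 'b set"
  assumes Y: "mm_space (dY, MY)" and X: "mm_space (dX, MX)"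
    and "0 < \<epsilon>" and "\<epsilon> < 1 / 24" and "5 * \<epsilon> < \<delta>"
    and V: "V \<in> sets MY" "measure MY V > 1 - \<epsilon>"
    and pigeonhole: "\<And>f :: nat \<Rightarrow> 'a \<Rightarrow> real. (\<And>j. j < P \<Longrightarrow> f j \<in> Lip1 (dY, MY)) \<Longrightarrow>
          \<exists>j<P. \<exists>l<P. j \<noteq> l \<and> (\<exists>c. \<forall>y\<in>V. \<bar>f j y - f l y - c\<bar> \<le> 3 * \<epsilon>)"
    and B: "\<And>A. A \<subseteq> {..<P} \<Longrightarrow> B A \<in> sets MX \<and> measure MX (B A) \<ge> 1 / (2 * 2 ^ P)"
    and sep: "\<And>A A' x y. A \<subseteq> {..<P} \<Longrightarrow> A' \<subseteq> {..<P} \<Longrightarrow> A \<noteq> A' \<Longrightarrow> x \<in> B A \<Longrightarrow> y \<in> B A' \<Longrightarrow>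
          \<delta> < mdist dX x y"
  shows "ennreal \<epsilon> \<le> d_conc (dY, MY) (dX, MX)"
proof (rule ccontr)
  let ?N = unit_interval_measure
  interpret N: prob_space ?N by (rule prob_space_unit_interval)
  have X': "space MX = mspace dX" "prob_space MX" using X by (auto simp: mm_space_def)
  interpret MX: prob_space MX by fact
  assume "\<not> ?thesis"
  then obtain \<phi> \<psi> where \<phi>: "parametrization (dY, MY) \<phi>" and \<psi>: "parametrization (dX, MX) \<psi>"
    and H: "Hausdorff_distance (me ?N) ((\<lambda>f. f \<circ> \<phi>) ` Lip1 (dY, MY)) ((\<lambda>g. g \<circ> \<psi>) ` Lip1 (dX, MX)) < ennreal \<epsilon>"
    unfolding d_conc_def not_le Inf_less_iff by blast
  from H obtain e where e: "ennreal e < ennreal \<epsilon>" "e > 0"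
    "\<forall>b\<in>(\<lambda>g. g \<circ> \<psi>) ` Lip1 (dX, MX). \<exists>a\<in>(\<lambda>f. f \<circ> \<phi>) ` Lip1 (dY, MY). me ?N b a < e"
    unfolding Hausdorff_distance_def Inf_less_iff by blast
  have "e < \<epsilon>" using e(1,2) by (simp add: ennreal_less_iff)
  have [measurable]: "\<phi> \<in> measurable ?N MY" "\<psi> \<in> measurable ?N MX"
    using \<phi> \<psi> by (auto simp: parametrization_def)
  define U where "U j = (\<Union>A\<in>{A \<in> Pow {..<P}. j \<in> A}. B A)" for j
  have BX: "B A \<subseteq> mspace dX" if "A \<subseteq> {..<P}" for A
    using B[OF that] sets.sets_into_space X' by blast
  have "\<forall>j\<in>{..<P}. \<exists>g. g \<in> Lip1 (dX, MX) \<and> (\<forall>x\<in>U j. g x = 0) \<and>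
            (\<forall>A. A \<subseteq> {..<P} \<longrightarrow> j \<notin> A \<longrightarrow> (\<forall>x\<in>B A. g x = \<delta>))"
  proof
    fix j assume "j \<in> {..<P}"
    then have j: "j < P" by simp
    have "0 < 1 / (2 * 2 ^ P :: real)" by simp
    also have "\<dots> \<le> measure MX (B {j})" using B[of "{j}"] j by auto
    finally have "B {j} \<noteq> {}" by auto
    then have "U j \<noteq> {}" using j by (auto simp: U_def)
    moreover have "U j \<subseteq> mspace dX" using BX by (auto simp: U_def)
    moreover have "0 \<le> \<delta>" using assms(3,5) by simp
    ultimately obtain g where g: "g \<in> Lip1 (dX, MX)" "\<And>x. x \<in> U j \<Longrightarrow> g x = 0"
      "\<And>x. x \<in> mspace dX \<Longrightarrow> (\<And>u. u \<in> U j \<Longrightarrow> \<delta> \<le> mdist dX u x) \<Longrightarrow> g x = \<delta>"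
      using Lip1_separating[of "U j" dX \<delta> MX] by blast
    have "g x = \<delta>" if "A \<subseteq> {..<P}" "j \<notin> A" "x \<in> B A" for A x
    proof (rule g(3))
      show "x \<in> mspace dX" using that BX by blast
      fix u assume "u \<in> U j"
      then obtain A' where A': "A' \<subseteq> {..<P}" "j \<in> A'" "u \<in> B A'" by (auto simp: U_def)
      then have "A' \<noteq> A" using that(2) by blast
      then show "\<delta> \<le> mdist dX u x" using sep[OF A'(1) that(1) _ A'(3) that(3)] by simp
    qed
    then show "\<exists>g. g \<in> Lip1 (dX, MX) \<and> (\<forall>x\<in>U j. g x = 0) \<and>
        (\<forall>A. A \<subseteq> {..<P} \<longrightarrow> j \<notin> A \<longrightarrow> (\<forall>x\<in>B A. g x = \<delta>))"
      using g(1,2) by blast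
  qed
  from bchoice[OF this] obtain g where G: "\<forall>j\<in>{..<P}. g j \<in> Lip1 (dX, MX) \<and> (\<forall>x\<in>U j. g j x = 0) \<and>
      (\<forall>A. A \<subseteq> {..<P} \<longrightarrow> j \<notin> A \<longrightarrow> (\<forall>x\<in>B A. g j x = \<delta>))" ..
  then have g: "\<And>j. j < P \<Longrightarrow> g j \<in> Lip1 (dX, MX)"
    and g0: "\<And>j A x. j < P \<Longrightarrow> A \<subseteq> {..<P} \<Longrightarrow> j \<in> A \<Longrightarrow> x \<in> B A \<Longrightarrow> g j x = 0"
    and g\<delta>: "\<And>j A x. j < P \<Longrightarrow> A \<subseteq> {..<P} \<Longrightarrow> j \<notin> A \<Longrightarrow> x \<in> B A \<Longrightarrow> g j x = \<delta>"
    unfolding U_def by auto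
  have "\<exists>f. f \<in> Lip1 (dY, MY) \<and> me ?N (g j \<circ> \<psi>) (f \<circ> \<phi>) < \<epsilon>" if "j < P" for j
  proof -
    have "g j \<circ> \<psi> \<in> (\<lambda>g. g \<circ> \<psi>) ` Lip1 (dX, MX)" using g[OF that] by blast
    with e(3) obtain f where "f \<in> Lip1 (dY, MY)" "me ?N (g j \<circ> \<psi>) (f \<circ> \<phi>) < e" by blast
    with \<open>e < \<epsilon>\<close> show ?thesis by (intro exI[of _ f]) simp
  qed
  then have "\<forall>j\<in>{..<P}. \<exists>f. f \<in> Lip1 (dY, MY) \<and> me ?N (g j \<circ> \<psi>) (f \<circ> \<phi>) < \<epsilon>" by simp
  from bchoice[OF this] obtain f where "\<forall>j\<in>{..<P}. f j \<in> Lip1 (dY, MY) \<and>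
      me ?N (g j \<circ> \<psi>) (f j \<circ> \<phi>) < \<epsilon>" ..
  then have f: "\<And>j. j < P \<Longrightarrow> f j \<in> Lip1 (dY, MY)"
    and me: "\<And>j. j < P \<Longrightarrow> me ?N (g j \<circ> \<psi>) (f j \<circ> \<phi>) < \<epsilon>"
    by simp_all
  have [measurable]: "g j \<in> borel_measurable MX" "f j \<in> borel_measurable MY" if "j < P" for j
    using Lip1_measurable[OF X g[OF that]] Lip1_measurable[OF Y f[OF that]] by auto
  obtain j l c where jl: "j < P" "l < P" "j \<noteq> l"
    and c: "\<And>y. y \<in> V \<Longrightarrow> \<bar>f j y - f l y - c\<bar> \<le> 3 * \<epsilon>"
    using pigeonhole[of f, OF f] by auto
  note [measurable] = \<open>V \<in> sets MY\<close>
  define E where "E i = {t \<in> space ?N. \<bar>(g i \<circ> \<psi>) t - (f i \<circ> \<phi>) t\<bar> > \<epsilon>}" for i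
  define Z where "Z = space ?N - (\<phi> -` V \<inter> space ?N)"
  have E: "E i \<in> sets ?N" "measure ?N (E i) \<le> \<epsilon>" if [simp]: "i < P" for i
    using me_less_imp[OF N.prob_space_axioms _ _ me[OF that]] jl unfolding E_def by measurable
  have Z: "Z \<in> sets ?N" "measure ?N Z < \<epsilon>"
    using V(2) parametrization_measure[OF \<phi> V(1)] N.prob_compl[of "\<phi> -` V \<inter> space ?N"]
    unfolding Z_def by auto
  have bad: "measure ?N (E j \<union> E l \<union> Z) < 1 / 8"
  proof -
    have "measure ?N (E j \<union> E l \<union> Z) \<le> measure ?N (E j) + measure ?N (E l) + measure ?N Z"
      using measure_Un_le[of "E j \<union> E l" ?N Z] measure_Un_le[of "E j" ?N "E l"] E jl Z by simp
    then show ?thesis using E(2)[OF jl(1)] E(2)[OF jl(2)] Z(2) assms(4) by simp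
  qed
  have witness: "\<exists>t\<in>space ?N. t \<notin> E j \<union> E l \<union> Z \<and> (\<exists>A\<subseteq>{..<P}. a \<in> A \<and> b \<notin> A \<and> \<psi> t \<in> B A)"
    if ab: "a < P" "b < P" "a \<noteq> b" for a b
  proof (rule ccontr)
    let ?S = "{A \<in> Pow {..<P}. a \<in> A \<and> b \<notin> A}"
    let ?W = "\<Union>A\<in>?S. B A"
    assume "\<not> ?thesis"
    then have sub: "\<psi> -` ?W \<inter> space ?N \<subseteq> E j \<union> E l \<union> Z" by blast
    have W: "?W \<in> sets MX" using B by (intro sets.finite_UN) auto
    have disj: "disjoint_family_on B ?S"
    proof -
      have False if "A \<subseteq> {..<P}" "A' \<subseteq> {..<P}" "A \<noteq> A'" "x \<in> B A" "x \<in> B A'" for A A' x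
      proof -
        have "x \<in> mspace dX" using BX[OF that(1)] that(4) by blast
        then have "mdist dX x x = 0" by simp
        with sep[OF that] show False using assms(3,5) by simp
      qed
      then show ?thesis unfolding disjoint_family_on_def by blast
    qed
    have "(1 / 8 :: real) = (\<Sum>A\<in>?S. 1 / (2 * 2 ^ P))"
    proof -
      have "real (4 * card ?S) = real (2 ^ P)"
        by (simp only: card_subsets_separating[OF ab])
      then have "4 * real (card ?S) = 2 ^ P" by simp
      then show ?thesis by (simp add: field_simps)
    qed
    also have "\<dots> \<le> (\<Sum>A\<in>?S. measure MX (B A))" by (rule sum_mono) (use B in blast)
    also have "\<dots> = measure MX ?W"
      by (rule MX.finite_measure_finite_Union[symmetric]) (use B disj in auto)
    also have "\<dots> = measure ?N (\<psi> -` ?W \<inter> space ?N)" using parametrization_measure[OF \<psi> W] ..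
    also have "\<dots> \<le> measure ?N (E j \<union> E l \<union> Z)" 
      using sub E(1)[OF jl(1)] E(1)[OF jl(2)] Z(1) by (intro N.finite_measure_mono) simp_all
    finally show False using bad by simp
  qed
  have close: "\<bar>g j (\<psi> t) - g l (\<psi> t) - c\<bar> \<le> 5 * \<epsilon>"
    if "t \<in> space ?N" "t \<notin> E j \<union> E l \<union> Z" for t
  proof -
    have "\<phi> t \<in> V" using that by (simp add: Z_def)
    moreover have "\<bar>g j (\<psi> t) - f j (\<phi> t)\<bar> \<le> \<epsilon>" "\<bar>g l (\<psi> t) - f l (\<phi> t)\<bar> \<le> \<epsilon>"
      using that by (simp_all add: E_def)
    ultimately show ?thesis using c[of "\<phi> t"] by linarith
  qed
  obtain t A where "t \<in> space ?N" "t \<notin> E j \<union> E l \<union> Z" "A \<subseteq> {..<P}" "j \<in> A" "l \<notin> A" "\<psi> t \<in> B A"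
    using witness[OF jl] by blast
  then have 1: "\<bar>- \<delta> - c\<bar> \<le> 5 * \<epsilon>" using close[of t] g0[of j A] g\<delta>[of l A] jl by simp
  obtain t A where "t \<in> space ?N" "t \<notin> E j \<union> E l \<union> Z" "A \<subseteq> {..<P}" "l \<in> A" "j \<notin> A" "\<psi> t \<in> B A"
    using witness[of l j] jl by blast
  then have "\<bar>\<delta> - c\<bar> \<le> 5 * \<epsilon>" using close[of t] g0[of l A] g\<delta>[of j A] jl by simp
  with 1 assms(5) show False by linarith
qed

text \<open>
  Fixing \<open>Y = X N\<close> first determines the number \<open>P\<close> of functions needed for the pigeonhole principle;
  only then is a later space chosen, on which \<open>2 ^ P\<close> separated sets are available.
\<close>

lemma dissipates_not_d_conc_Cauchy:
  assumes mm: "\<And>n. mm_space (X n)" and "dissipates X"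
  shows "\<not> d_conc_Cauchy X"
proof
  assume Cauchy: "d_conc_Cauchy X"
  obtain \<delta> where \<delta>: "\<delta> > 0" "delta_dissipates \<delta> X" using assms(2) by (auto simp: dissipates_def)
  \<comment> \<open>The half of \<open>\<delta>\<close> at which separated sets are available must exceed \<open>5 * \<epsilon>\<close>.\<close>
  define \<epsilon> where "\<epsilon> = min (1 / 25) (\<delta> / 15)"
  have \<epsilon>: "0 < \<epsilon>" "\<epsilon> < 1 / 24" "5 * \<epsilon> < \<delta> / 2" using \<delta>(1) by (auto simp: \<epsilon>_def min_def)
  obtain N where N: "\<And>m n. m \<ge> N \<Longrightarrow> n \<ge> N \<Longrightarrow> d_conc (X m) (X n) < ennreal \<epsilon>"
    using Cauchy \<epsilon>(1) unfolding d_conc_Cauchy_def by blast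
  obtain dY MY where Y: "X N = (dY, MY)" by force
  have mmY: "mm_space (dY, MY)" using mm[of N] by (simp add: Y)
  obtain F where F: "finite F" "F \<subseteq> mspace dY" "measure MY (\<Union>x\<in>F. mball_of dY x \<epsilon>) > 1 - \<epsilon>"
    using finitely_many_balls_almost_cover[OF mmY \<epsilon>(1)] by blast
  obtain P where P: "P \<ge> 2"
    and pigeonhole: "\<And>f :: nat \<Rightarrow> 'a \<Rightarrow> real. (\<And>j. j < P \<Longrightarrow> f j \<in> Lip1 (dY, MY)) \<Longrightarrow>
           \<exists>j<P. \<exists>l<P. j \<noteq> l \<and> (\<exists>c. \<forall>y\<in>(\<Union>x\<in>F. mball_of dY x \<epsilon>). \<bar>f j y - f l y - c\<bar> \<le> 3 * \<epsilon>)"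
    using Lip1_pigeonhole[OF F(1,2) \<epsilon>(1)] by metis
  let ?I = "Pow {..<P}"
  have card: "card ?I = 2 ^ P" by (simp add: card_Pow)
  have "card ?I \<ge> 2" unfolding card using P by (metis Suc_1 Suc_leD one_le_numeral power_increasing power_one_right)
  then have "\<forall>\<^sub>F n in sequentially. \<exists>B.
           (\<forall>i\<in>?I. B i \<in> sets (snd (X n)) \<and> measure (snd (X n)) (B i) \<ge> 1 / (2 * card ?I)) \<and>
           (\<forall>i\<in>?I. \<forall>j\<in>?I. i \<noteq> j \<longrightarrow> (\<forall>x\<in>B i. \<forall>y\<in>B j. \<delta> / 2 < mdist (fst (X n)) x y))"
    using \<delta> by (intro delta_dissipates_separated_sets) auto
  with eventually_ge_at_top[of N] have "\<forall>\<^sub>F n in sequentially. n \<ge> N \<and> (\<exists>B.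
           (\<forall>i\<in>?I. B i \<in> sets (snd (X n)) \<and> measure (snd (X n)) (B i) \<ge> 1 / (2 * card ?I)) \<and>
           (\<forall>i\<in>?I. \<forall>j\<in>?I. i \<noteq> j \<longrightarrow> (\<forall>x\<in>B i. \<forall>y\<in>B j. \<delta> / 2 < mdist (fst (X n)) x y)))"
    by eventually_elim blast
  then obtain n B where n: "n \<ge> N"
    and B: "\<And>A. A \<in> ?I \<Longrightarrow> B A \<in> sets (snd (X n)) \<and> measure (snd (X n)) (B A) \<ge> 1 / (2 * card ?I)"
    and sep: "\<And>A A' x y. A \<in> ?I \<Longrightarrow> A' \<in> ?I \<Longrightarrow> A \<noteq> A' \<Longrightarrow> x \<in> B A \<Longrightarrow> y \<in> B A' \<Longrightarrow>
                \<delta> / 2 < mdist (fst (X n)) x y"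
    by (auto dest!: eventually_happens) blast
  have "ennreal \<epsilon> \<le> d_conc (dY, MY) (fst (X n), snd (X n))"
  proof (rule d_conc_lower_bound[where \<delta> = "\<delta> / 2" and B = B and P = P])
    show "(\<Union>x\<in>F. mball_of dY x \<epsilon>) \<in> sets MY"
      using F(1) by (intro sets.finite_UN open_in_mm_space_measurable[OF mmY] openin_mball_of)
    show "\<exists>j<P. \<exists>l<P. j \<noteq> l \<and> (\<exists>c. \<forall>y\<in>(\<Union>x\<in>F. mball_of dY x \<epsilon>). \<bar>f j y - f l y - c\<bar> \<le> 3 * \<epsilon>)"
      if "\<And>j. j < P \<Longrightarrow> f j \<in> Lip1 (dY, MY)" for f :: "nat \<Rightarrow> 'a \<Rightarrow> real"
      using pigeonhole[OF that] .
  qed (use mm[of n] mmY \<epsilon> P F B sep card in \<open>auto\<close>)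
  with N[of N n] n Y show False by simp
qed

lemma dissipates_subseq:
  assumes "dissipates X" and "strict_mono r"
  shows "dissipates (\<lambda>n. X (r n))"
proof -
  obtain \<delta> where "\<delta> > 0" and \<delta>: "delta_dissipates \<delta> X" using assms(1) by (auto simp: dissipates_def)
  have "liminf (\<lambda>n. Sep (X n) m \<kappa>) \<le> liminf (\<lambda>n. Sep (X (r n)) m \<kappa>)" for m \<kappa>
    using liminf_subseq_mono[OF assms(2), of "\<lambda>n. Sep (X n) m \<kappa>"] by (simp add: o_def)
  then have "delta_dissipates \<delta> (\<lambda>n. X (r n))"
    using \<delta> unfolding delta_dissipates_def by (blast intro: order_trans)
  then show ?thesis using \<open>\<delta> > 0\<close> by (auto simp: dissipates_def)
qed

section \<open>Open subgroups of compact groups\<close>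

text \<open>
  The coset is the preimage of \<open>H\<close> under the continuous map \<open>\<lambda>y. y \<otimes> inv x\<close>.
\<close>

lemma (in topological_group) openin_rcoset:
  assumes "openin T H" and "x \<in> carrier G"
  shows "openin T (H #> x)"
proof -
  have H: "H \<subseteq> carrier G" using openin_subset[OF assms(1)] topspace_eq by simp
  have "continuous_map T (prod_topology T T) (\<lambda>y. (y, inv x))"
    using assms(2) by (simp add: continuous_map_paired topspace_eq)
  from continuous_map_compose[OF this continuous_mult]
  have "continuous_map T T (\<lambda>y. y \<otimes> inv x)" by (simp add: o_def)
  then have "openin T {y \<in> topspace T. y \<otimes> inv x \<in> H}"
    using assms(1) by (rule openin_continuous_map_preimage)
  also have "{y \<in> topspace T. y \<otimes> inv x \<in> H} = H #> x"
  proof (intro equalityI subsetI)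
    fix y assume "y \<in> {y \<in> topspace T. y \<otimes> inv x \<in> H}"
    then have y: "y \<in> carrier G" "y \<otimes> inv x \<in> H" by (auto simp: topspace_eq)
    then have "y = y \<otimes> inv x \<otimes> x" using assms(2) by (simp add: m_assoc)
    then show "y \<in> H #> x" using y(2) unfolding r_coset_def by blast
  next
    fix y assume "y \<in> H #> x"
    then obtain h where "h \<in> H" "y = h \<otimes> x" unfolding r_coset_def by blast
    then show "y \<in> {y \<in> topspace T. y \<otimes> inv x \<in> H}"
      using H assms(2) by (auto simp: topspace_eq m_assoc subset_iff)
  qed
  finally show ?thesis .
qed

lemma (in topological_group) topological_group_subgroup:
  assumes "subgroup K G"
  shows "topological_group (G\<lparr>carrier := K\<rparr>) (subtopology T K)"
proof (rule topological_group.intro)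
  show "group (G\<lparr>carrier := K\<rparr>)" using assms by (rule subgroup_imp_group)
  have K: "K \<subseteq> carrier G" using assms by (rule subgroup.subset)
  show "topological_group_axioms (G\<lparr>carrier := K\<rparr>) (subtopology T K)"
  proof
    show "topspace (subtopology T K) = carrier (G\<lparr>carrier := K\<rparr>)"
      using K topspace_eq by auto
    have "continuous_map (prod_topology (subtopology T K) (subtopology T K)) T (\<lambda>(x, y). x \<otimes> y)"
      unfolding prod_topology_subtopology(1) subtopology_subtopology
      by (simp add: prod_topology_subtopology continuous_map_from_subtopology continuous_mult)
    then show "continuous_map (prod_topology (subtopology T K) (subtopology T K)) (subtopology T K)
        (\<lambda>(x, y). x \<otimes>\<^bsub>G\<lparr>carrier := K\<rparr>\<^esub> y)"
      using subgroup.m_closed[OF assms] by (auto simp: continuous_map_in_subtopology)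
    have "continuous_map (subtopology T K) (subtopology T K) (\<lambda>x. inv x)"
      using subgroup.m_inv_closed[OF assms]
      by (auto simp: continuous_map_in_subtopology continuous_map_from_subtopology continuous_inv)
    then show "continuous_map (subtopology T K) (subtopology T K) (\<lambda>x. inv\<^bsub>G\<lparr>carrier := K\<rparr>\<^esub> x)"
      by (rule continuous_map_eq) (use m_inv_consistent[OF assms] in auto)
  qed
qed

text \<open>
  The right cosets form an open cover by nonempty disjoint sets, which has no proper subcover.
\<close>

lemma (in topological_group) finite_rcosets_open_subgroup:
  assumes "compact_space T" and H: "subgroup H G" and "openin T H"
  shows "finite (rcosets H)"
proof -
  have "\<And>C. C \<in> rcosets H \<Longrightarrow> openin T C"
    using openin_rcoset[OF assms(3)] by (auto simp: RCOSETS_def)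
  moreover have "\<Union>(rcosets H) = topspace T" using rcosets_part_G[OF H] topspace_eq by simp
  ultimately obtain F where F: "finite F" "F \<subseteq> rcosets H" "topspace T \<subseteq> \<Union>F"
    using assms(1) unfolding compact_space_alt by (metis order_refl)
  have "rcosets H \<subseteq> F"
  proof
    fix C assume C: "C \<in> rcosets H"
    then obtain x where x: "x \<in> C" using subgroup.rcosets_non_empty[OF H] by blast
    then have "x \<in> topspace T" using C rcosets_part_G[OF H] topspace_eq by auto
    then obtain C' where C': "C' \<in> F" "x \<in> C'" using F(3) by blast
    then have "C' = C" using rcos_disjoint[OF H] C F(2) x by (auto simp: pairwise_def disjnt_def)
    then show "C \<in> F" using C' by simp
  qed
  then show ?thesis using F(1) by (rule finite_subset)
qed

text \<open>
  Since the measure is only given as left-invariant, while two right cosets are right translates of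
  each other, equality of their measures requires an argument, though unimodularity can be avoided.
  Fix \<open>x\<close> and pull the partition into right cosets back along the bijection \<open>\<lambda>z. x \<otimes> inv z\<close>. The piece
  over \<open>H #> y\<close> is \<open>inv y <# (H #> x)\<close>, a left translate of the fixed coset \<open>H #> x\<close>. So the whole
  group is partitioned into as many left translates of \<open>H #> x\<close> as there are right cosets.
\<close>

lemma (in topological_group) Haar_measure_rcoset:
  assumes Haar: "normalized_Haar_measure G T M" and H: "subgroup H G" and "openin T H"
    and fin: "finite (rcosets H)" and x: "x \<in> carrier G"
  shows "measure M (H #> x) = 1 / card (rcosets H)"
proof -
  interpret prob_space M using Haar by (simp add: normalized_Haar_measure_def)
  have sp: "space M = carrier G" and sets: "sets M = sets (borel_of T)"
    and inv_M: "\<And>g A. g \<in> carrier G \<Longrightarrow> A \<in> sets M \<Longrightarrow> emeasure M (g <# A) = emeasure M A"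
    using Haar topspace_eq by (auto simp: normalized_Haar_measure_def)
  have meas: "H #> y \<in> sets M" if "y \<in> carrier G" for y
    using openin_rcoset[OF assms(3) that] by (simp add: sets openin_imp_borel_of)
  have Hc: "H \<subseteq> carrier G" using H by (rule subgroup.subset)
  define D where "D C = {z \<in> carrier G. x \<otimes> inv z \<in> C}" for C
  have D_eq: "D (H #> y) = inv y <# (H #> x)" if y: "y \<in> carrier G" for y
  proof (intro equalityI subsetI)
    fix z assume "z \<in> D (H #> y)"
    then obtain h where z: "z \<in> carrier G" and h: "h \<in> H" "x \<otimes> inv z = h \<otimes> y"
      by (auto simp: D_def r_coset_def)
    have hc: "h \<in> carrier G" using h Hc by blast
    have "x = h \<otimes> y \<otimes> z" using h(2) x y z hc by (metis inv_solve_right m_closed)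
    then have "inv h \<otimes> x = y \<otimes> z" using hc y z by (simp add: m_assoc inv_solve_left')
    then have "z = inv y \<otimes> (inv h \<otimes> x)" using y z x hc by (simp add: m_assoc[symmetric])
    then show "z \<in> inv y <# (H #> x)"
      using subgroup.m_inv_closed[OF H h(1)] by (auto simp: l_coset_def r_coset_def)
  next
    fix z assume "z \<in> inv y <# (H #> x)"
    then obtain h where h: "h \<in> H" "z = inv y \<otimes> (h \<otimes> x)" by (auto simp: l_coset_def r_coset_def)
    have hc: "h \<in> carrier G" using h Hc by blast
    have "x \<otimes> inv z = inv h \<otimes> y"
      using h(2) hc x y by (simp add: inv_mult_group m_assoc[symmetric])
    then show "z \<in> D (H #> y)"
      using subgroup.m_inv_closed[OF H h(1)] h(2) hc x y by (auto simp: D_def r_coset_def)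
  qed
  have D_meas: "D C \<in> sets M \<and> measure M (D C) = measure M (H #> x)" if CH: "C \<in> rcosets H" for C
  proof -
    obtain y where y: "y \<in> carrier G" and C: "C = H #> y" using CH by (auto simp: RCOSETS_def)
    have "continuous_map T (prod_topology T T) (\<lambda>z. (x, inv z))"
      using x by (simp add: continuous_map_paired topspace_eq continuous_inv)
    from continuous_map_compose[OF this continuous_mult]
    have "continuous_map T T (\<lambda>z. x \<otimes> inv z)" by (simp add: o_def)
    then have "openin T (D C)"
      unfolding D_def topspace_eq[symmetric] C
      using openin_rcoset[OF assms(3) y] by (rule openin_continuous_map_preimage)
    then have "D C \<in> sets M" by (simp add: sets openin_imp_borel_of)
    moreover have "emeasure M (D C) = emeasure M (H #> x)"
      unfolding C D_eq[OF y] using y meas[OF x] by (intro inv_M) auto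
    ultimately show ?thesis by (simp add: measure_def)
  qed
  have "disjoint_family_on D (rcosets H)"
    using rcos_disjoint[OF H] by (auto simp: disjoint_family_on_def D_def pairwise_def disjnt_def)
  then have "measure M (\<Union>C\<in>rcosets H. D C) = (\<Sum>C\<in>rcosets H. measure M (D C))"
    using fin D_meas by (intro finite_measure_finite_Union) auto
  also have "\<dots> = card (rcosets H) * measure M (H #> x)" using D_meas by simp
  also have "(\<Union>C\<in>rcosets H. D C) = space M"
    using rcosets_part_G[OF H] x by (auto simp: D_def sp)
  finally have "card (rcosets H) * measure M (H #> x) = 1" using prob_space by simp
  then show ?thesis
    by (cases "card (rcosets H) = 0") (simp_all add: nonzero_eq_divide_eq mult.commute)
qed

text \<open>
  By right-invariance the distance from \<open>x\<close> to \<open>y\<close> is that from \<open>x \<otimes> inv y\<close> to the identity, and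
  \<open>x \<otimes> inv y\<close> lies outside \<open>H\<close> when the cosets differ.
\<close>

lemma (in group) rcosets_separated:
  assumes d: "mspace d = carrier G" and right: "right_invariant_metric G d"
    and H: "subgroup H G" and ball: "\<And>x. x \<in> carrier G \<Longrightarrow> mdist d x \<one> < \<delta> \<Longrightarrow> x \<in> H"
    and x: "x \<in> carrier G" and y: "y \<in> carrier G" and ne: "H #> x \<noteq> H #> y"
  shows "\<delta> \<le> mdist d x y"
proof (rule ccontr)
  assume "\<not> ?thesis"
  moreover have "mdist d (x \<otimes> inv y) (y \<otimes> inv y) = mdist d x y"
    using right x y unfolding right_invariant_metric_def by blast
  ultimately have "mdist d (x \<otimes> inv y) \<one> < \<delta>" using y by simp
  then have "x \<otimes> inv y \<in> H" using ball x y by simp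
  then have "x \<in> H #> y" using subgroup.rcos_module_rev[OF H is_group y x] by simp
  then show False using repr_independence[OF _ y H] ne by simp
qed

lemma disjoint_subsets_of_given_cards:
  assumes "finite R" and "(\<Sum>i<k. c i) \<le> card R"
  shows "\<exists>I :: nat \<Rightarrow> 'a set. (\<forall>i<k. I i \<subseteq> R \<and> card (I i) = c i) \<and>
           (\<forall>i<k. \<forall>j<k. i \<noteq> j \<longrightarrow> I i \<inter> I j = {})"
  using assms(2)
proof (induction k)
  case 0
  show ?case by simp
next
  case (Suc k)
  then have "(\<Sum>i<k. c i) \<le> card R" by simp
  from Suc.IH[OF this] obtain I where "(\<forall>i<k. I i \<subseteq> R \<and> card (I i) = c i) \<and>
      (\<forall>i<k. \<forall>j<k. i \<noteq> j \<longrightarrow> I i \<inter> I j = {})" ..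
  then have I: "\<And>i. i < k \<Longrightarrow> I i \<subseteq> R \<and> card (I i) = c i"
    and disj: "\<And>i j. i < k \<Longrightarrow> j < k \<Longrightarrow> i \<noteq> j \<Longrightarrow> I i \<inter> I j = {}"
    by auto
  let ?U = "\<Union>i<k. I i"
  have U: "?U \<subseteq> R" using I by blast
  have "card ?U \<le> (\<Sum>i<k. card (I i))" by (rule card_UN_le) simp
  also have "\<dots> = (\<Sum>i<k. c i)" using I by (intro sum.cong) auto
  finally have "c k \<le> card (R - ?U)"
    using Suc.prems card_Diff_subset[OF finite_subset[OF U assms(1)] U] by simp
  then obtain S where S: "S \<subseteq> R - ?U" "card S = c k"
    using obtain_subset_with_card_n by metis
  have dS: "S \<inter> I i = {}" if "i < k" for i using S(1) that by blast
  have ik: "i = k \<or> i < k" if "i < Suc k" for i using that by auto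
  show ?case
  proof (intro exI[of _ "I(k := S)"] conjI allI impI)
    fix i assume "i < Suc k"
    then show "(I(k := S)) i \<subseteq> R" using I S(1) ik by (cases "i = k") auto
  next
    fix i assume "i < Suc k"
    then show "card ((I(k := S)) i) = c i" using I S(2) ik by (cases "i = k") auto
  next
    fix i j assume "i < Suc k" "j < Suc k" "i \<noteq> j"
    then show "(I(k := S)) i \<inter> (I(k := S)) j = {}"
      using ik[of i] ik[of j] dS disj by (auto simp: Int_commute)
  qed
qed

text \<open>
  Each \<open>B i\<close> is a union of right cosets, taken in the least number \<open>c i\<close> that has measure at least
  \<open>\<kappa> i\<close>. Rounding up costs less than one coset for each of the \<open>m + 1\<close> indices, and the hypothesis on
  the index provides for that.
\<close>

lemma (in topological_group) Sep_Haar_measure_lower_bound: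
  fixes \<kappa> :: "nat \<Rightarrow> real"
  assumes Haar: "normalized_Haar_measure G T M" and "compact_space T"
    and d: "mspace d = carrier G" and right: "right_invariant_metric G d"
    and H: "subgroup H G" and op: "openin T H"
    and ball: "\<And>x. x \<in> carrier G \<Longrightarrow> mdist d x \<one> < \<delta> \<Longrightarrow> x \<in> H"
    and pos: "\<And>i. i \<le> m \<Longrightarrow> 0 < \<kappa> i"
    and index: "real (m + 1) \<le> (1 - (\<Sum>i\<le>m. \<kappa> i)) * card (rcosets H)"
  shows "ennreal \<delta> \<le> Sep (d, M) m \<kappa>"
proof -
  interpret prob_space M using Haar by (simp add: normalized_Haar_measure_def)
  have sets: "sets M = sets (borel_of T)" using Haar by (simp add: normalized_Haar_measure_def)
  let ?R = "rcosets H" and ?N = "card (rcosets H)"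
  have fin: "finite ?R" using assms(2) H op by (rule finite_rcosets_open_subgroup)
  have "?N \<noteq> 0" using index by (auto intro: ccontr)
  define c where "c i = nat \<lceil>\<kappa> i * ?N\<rceil>" for i
  have c_ge: "\<kappa> i * ?N \<le> real (c i)" for i unfolding c_def by linarith
  have c_le: "real (c i) \<le> \<kappa> i * ?N + 1" if "i \<le> m" for i
  proof -
    have "0 \<le> \<kappa> i * ?N" using pos[OF that] by simp
    then show ?thesis unfolding c_def by linarith
  qed
  have "real (\<Sum>i<Suc m. c i) \<le> (\<Sum>i<Suc m. \<kappa> i * ?N + 1)"
    unfolding of_nat_sum by (intro sum_mono c_le) simp
  also have "\<dots> = (\<Sum>i\<le>m. \<kappa> i) * ?N + real (m + 1)"
    by (simp add: sum.distrib sum_distrib_right lessThan_Suc_atMost del: sum.lessThan_Suc)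
  also have "\<dots> \<le> ?N" using index by (simp add: left_diff_distrib)
  finally have "(\<Sum>i<Suc m. c i) \<le> ?N" by linarith
  from disjoint_subsets_of_given_cards[OF fin this] obtain I
    where "(\<forall>i<Suc m. I i \<subseteq> ?R \<and> card (I i) = c i) \<and>
      (\<forall>i<Suc m. \<forall>j<Suc m. i \<noteq> j \<longrightarrow> I i \<inter> I j = {})" ..
  then have I: "\<And>i. i \<le> m \<Longrightarrow> I i \<subseteq> ?R" "\<And>i. i \<le> m \<Longrightarrow> card (I i) = c i"
      and disj: "\<And>i j. i \<le> m \<Longrightarrow> j \<le> m \<Longrightarrow> i \<noteq> j \<Longrightarrow> I i \<inter> I j = {}"
    by (simp_all add: less_Suc_eq_le)
  have R: "C \<in> sets M \<and> measure M C = 1 / ?N" if C: "C \<in> ?R" for C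
  proof -
    obtain x where "x \<in> carrier G" "C = H #> x" using C by (auto simp: RCOSETS_def)
    then show ?thesis
      using Haar_measure_rcoset[OF Haar H op fin] openin_rcoset[OF op]
      by (simp add: sets openin_imp_borel_of)
  qed
  define B where "B i = \<Union>(I i)" for i
  have B: "B i \<in> sets M \<and> \<kappa> i \<le> measure M (B i)" if i: "i \<le> m" for i
  proof -
    have fI: "finite (I i)" using I(1)[OF i] fin by (rule finite_subset)
    have "disjoint_family_on (\<lambda>C. C) (I i)"
      using rcos_disjoint[OF H] I(1)[OF i]
      by (auto simp: disjoint_family_on_def pairwise_def disjnt_def)
    then have "measure M (\<Union>C\<in>I i. C) = (\<Sum>C\<in>I i. measure M C)"
      using fI R I(1)[OF i] by (intro finite_measure_finite_Union) auto
    also have "\<dots> = (\<Sum>C\<in>I i. 1 / ?N)" using R I(1)[OF i] by (intro sum.cong) auto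
    also have "\<dots> = c i / ?N" using I(2)[OF i] by simp
    also have "\<dots> \<ge> \<kappa> i" using c_ge[of i] \<open>?N \<noteq> 0\<close> by (simp add: le_divide_eq)
    finally have "\<kappa> i \<le> measure M (B i)" by (simp add: B_def)
    moreover have "B i \<in> sets M" unfolding B_def using fI R I(1)[OF i] by (intro sets.finite_Union) auto
    ultimately show ?thesis by simp
  qed
  have sep: "\<delta> \<le> mdist d x y" if ij: "i \<le> m" "j \<le> m" "i \<noteq> j" and x: "x \<in> B i" and y: "y \<in> B j" for i j x y
  proof -
    obtain C D where CD: "C \<in> I i" "x \<in> C" "D \<in> I j" "y \<in> D" using x y by (auto simp: B_def)
    then have ne: "C \<noteq> D" using disj[OF ij] by blast
    have CR: "C \<in> ?R" and DR: "D \<in> ?R" using CD I(1) ij by blast+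
    then obtain u v where uv: "u \<in> carrier G" "v \<in> carrier G" "C = H #> u" "D = H #> v"
      by (auto simp: RCOSETS_def)
    have xy: "x \<in> carrier G" "y \<in> carrier G"
      using CR DR CD subgroup.rcosets_carrier[OF H is_group] by blast+
    have "H #> x = C" "H #> y = D"
      using repr_independence[OF _ _ H] CD uv by metis+
    then show ?thesis
      using rcosets_separated[OF d right H ball xy] ne by simp
  qed
  have "ennreal \<delta> \<le> Inf {ennreal (mdist d x y) | i j x y. i \<le> m \<and> j \<le> m \<and> i \<noteq> j \<and> x \<in> B i \<and> y \<in> B j}"
    using sep by (intro Inf_greatest) (auto intro: ennreal_leI)
  also have "\<dots> \<le> Sep (d, M) m \<kappa>"
    unfolding Sep_def case_prod_conv using B by (intro SUP_upper) auto
  finally show ?thesis .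
qed

text \<open>
  Compactness gives completeness, and, through finite \<open>1 / Suc n\<close>-nets for all \<open>n\<close>, separability.
\<close>

lemma mm_space_compact_Haar:
  assumes "mtopology_of d = T" and "compact_space T" and "normalized_Haar_measure G T M"
  shows "mm_space (d, M)"
proof -
  interpret Metric_space "mspace d" "mdist d" by simp
  have T: "mtopology = T" using assms(1) by (simp add: mtopology_of_def)
  have "mcomplete_of d"
    using compact_space_imp_mcomplete assms(2) T by (simp add: mcomplete_of_def)
  moreover have "separable_space T"
  proof -
    have "mtotally_bounded (mspace d)"
      using compactin_imp_mtotally_bounded assms(2) T by (metis compact_space_def topspace_mtopology)
    then have "\<forall>n::nat. \<exists>F. finite F \<and> F \<subseteq> mspace d \<and> mspace d \<subseteq> (\<Union>x\<in>F. mball x (1 / Suc n))"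
      unfolding mtotally_bounded_def by simp
    then obtain F where F: "\<And>n::nat. finite (F n)" "\<And>n. F n \<subseteq> mspace d"
      "\<And>n. mspace d \<subseteq> (\<Union>x\<in>F n. mball x (1 / Suc n))"
      by metis
    have "x \<in> mtopology closure_of (\<Union>n. F n)" if x: "x \<in> mspace d" for x
      unfolding metric_closure_of
    proof (intro CollectI conjI allI impI x)
      fix r :: real assume "0 < r"
      then obtain n where n: "1 / real (Suc n) < r" using nat_approx_posE by blast
      obtain y where y: "y \<in> F n" "x \<in> mball y (1 / Suc n)" using F(3)[of n] x by blast
      then show "\<exists>y\<in>\<Union>n. F n. y \<in> mball x r" using n by (intro bexI[of _ y]) (auto simp: commute)
    qed
    then have "mtopology closure_of (\<Union>n. F n) = mspace d"
      using closure_of_subset_topspace[of mtopology] by auto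
    then show ?thesis
      using F(1,2) unfolding separable_space_def T[symmetric]
      by (intro exI[of _ "\<Union>n. F n"]) (auto intro: countable_finite)
  qed
  ultimately show ?thesis
    using assms(1,3) topspace_mtopology T by (auto simp: mm_space_def normalized_Haar_measure_def)
qed

section \<open>Growth of the index along a dense chain\<close>

text \<open>
  Each of \<open>k\<close> distinct right cosets of \<open>H\<close> is open and nonempty, so it meets some \<open>K n\<close>. From some
  stage on, all of them meet \<open>K n\<close>, and points of \<open>K n\<close> in different right cosets of \<open>H\<close> lie in
  different right cosets of \<open>H \<inter> K n\<close>.
\<close>

lemma (in topological_group) index_in_dense_chain_tendsto_infinity:
  assumes "incseq K" and K: "\<And>n. subgroup (K n) G" and compact: "\<And>n. compactin T (K n)"
    and dense: "T closure_of (\<Union>n. K n) = carrier G"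
    and H: "subgroup H G" and op: "openin T H" and inf: "infinite (rcosets H)"
  shows "\<forall>\<^sub>F n in sequentially. k \<le> card (rcosets\<^bsub>G\<lparr>carrier := K n\<rparr>\<^esub> (H \<inter> K n))"
proof -
  obtain \<C> where \<C>: "\<C> \<subseteq> rcosets H" "finite \<C>" "card \<C> = k"
    using infinite_arbitrarily_large[OF inf] by blast
  have "\<exists>x n. x \<in> C \<and> x \<in> K n" if C: "C \<in> \<C>" for C
  proof -
    obtain a where a: "a \<in> carrier G" "C = H #> a" using C \<C>(1) by (auto simp: RCOSETS_def)
    have "openin T C" "a \<in> C" using openin_rcoset[OF op a(1)] rcos_self[OF a(1) H] a(2) by auto
    moreover have "a \<in> T closure_of (\<Union>n. K n)" using a(1) dense by simp
    ultimately show ?thesis unfolding in_closure_of by blast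
  qed
  then obtain x n where xn: "\<And>C. C \<in> \<C> \<Longrightarrow> x C \<in> C \<and> x C \<in> K (n C)" by metis
  define N where "N = Max (insert 0 (n ` \<C>))"
  have le_N: "n C \<le> N" if "C \<in> \<C>" for C using that \<C>(2) by (simp add: N_def)
  show ?thesis
  proof (rule eventually_sequentiallyI[of N])
    fix j assume j: "N \<le> j"
    let ?G = "G\<lparr>carrier := K j\<rparr>" and ?H = "H \<inter> K j"
    interpret Kj: topological_group ?G "subtopology T (K j)"
      using K by (rule topological_group_subgroup)
    have HK: "subgroup ?H ?G"
      using H K by (intro subgroup_incl subgroups_Inter_pair) auto
    have "finite (rcosets\<^bsub>?G\<^esub> ?H)"
    proof (rule Kj.finite_rcosets_open_subgroup[OF _ HK])
      show "compact_space (subtopology T (K j))" using compact by (rule compact_space_subtopology)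
      show "openin (subtopology T (K j)) ?H" using op by (rule openin_subtopology_Int)
    qed
    moreover have xK: "x C \<in> K j" if "C \<in> \<C>" for C
      using xn[OF that] le_N[OF that] j \<open>incseq K\<close> unfolding incseq_def by (meson order_trans subsetD)
    have "inj_on (\<lambda>C. ?H #>\<^bsub>?G\<^esub> x C) \<C>"
    proof (rule inj_onI)
      fix C D assume CD: "C \<in> \<C>" "D \<in> \<C>" and eq: "?H #>\<^bsub>?G\<^esub> x C = ?H #>\<^bsub>?G\<^esub> x D"
      have "x C \<in> ?H #>\<^bsub>?G\<^esub> x C" using Kj.rcos_self[OF _ HK] xK CD by simp
      then have "x C \<in> H #> x D" unfolding eq by (auto simp: r_coset_def)
      moreover obtain a b where ab: "a \<in> carrier G" "C = H #> a" "b \<in> carrier G" "D = H #> b"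
        using CD[THEN subsetD[OF \<C>(1)]] by (auto simp: RCOSETS_def)
      moreover have "x D \<in> carrier G" using xK[OF CD(2)] subgroup.subset[OF K] by blast
      ultimately show "C = D" using repr_independence[OF _ _ H] xn[OF CD(1)] xn[OF CD(2)] by metis
    qed
    moreover have "(\<lambda>C. ?H #>\<^bsub>?G\<^esub> x C) ` \<C> \<subseteq> rcosets\<^bsub>?G\<^esub> ?H"
      using xK by (auto simp: RCOSETS_def)
    ultimately show "k \<le> card (rcosets\<^bsub>?G\<^esub> ?H)"
      using card_inj_on_le \<C>(3) by blast
  qed
qed

theorem corollary5p3:
  fixes G :: "('a, 'b) monoid_scheme" (structure)
    and T :: "'a topology"
    and d :: "'a metric"
    and K :: "nat \<Rightarrow> 'a set"
    and \<mu> :: "nat \<Rightarrow> 'a measure"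
  assumes "topological_group G T"
    and "metrizable_space T"
    and "mspace d = carrier G" and "mtopology_of d = T"
    and "right_invariant_metric G d"
    and "incseq K"
    and "\<And>n. subgroup (K n) G"
    and "\<And>n. compactin T (K n)"
    and "T closure_of (\<Union>n. K n) = carrier G"
    and "\<And>n. normalized_Haar_measure (G\<lparr>carrier := K n\<rparr>) (subtopology T (K n)) (\<mu> n)"
    and "\<exists>H. subgroup H G \<and> openin T H \<and> infinite (rcosets H)"
  shows "(\<forall>n. mm_space (submetric d (K n), \<mu> n)) \<and>
         dissipates (\<lambda>n. (submetric d (K n), \<mu> n)) \<and>
         \<not> (\<exists>r. strict_mono r \<and> d_conc_Cauchy (\<lambda>n. (submetric d (K (r n)), \<mu> (r n))))"
proof -
  interpret topological_group G T by fact
  note K = assms(7) and compact = assms(8) and Haar = assms(10)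
  let ?X = "\<lambda>n. (submetric d (K n), \<mu> n)"
  have KG: "K n \<subseteq> carrier G" for n using K by (rule subgroup.subset)
  have compactK: "compact_space (subtopology T (K n))" for n
    using compact by (rule compact_space_subtopology)
  have mm: "mm_space (?X n)" for n
    using compactK Haar
    by (intro mm_space_compact_Haar) (simp_all add: mtopology_of_submetric assms(4))
  obtain H where H: "subgroup H G" and op: "openin T H" and inf: "infinite (rcosets H)"
    using assms(11) by blast
  have "\<one> \<in> H" using H by (rule subgroup.one_closed)
  interpret d: Metric_space "mspace d" "mdist d" by simp
  obtain \<delta> where \<delta>: "\<delta> > 0" "d.mball \<one> \<delta> \<subseteq> H"
    using op \<open>\<one> \<in> H\<close> unfolding assms(4)[symmetric] mtopology_of_def d.openin_mtopology by blast
  have ball: "x \<in> H" if "x \<in> carrier G" "mdist d x \<one> < \<delta>" for x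
  proof -
    have "x \<in> d.mball \<one> \<delta>"
      using that d.commute[of x \<one>] unfolding d.in_mball unfolding assms(3) by simp
    then show ?thesis using \<delta>(2) by blast
  qed
  have "delta_dissipates \<delta> ?X"
    unfolding delta_dissipates_def
  proof (intro allI impI)
    fix m :: nat and \<kappa> :: "nat \<Rightarrow> real"
    assume "m \<noteq> 0" and pos: "\<forall>i\<le>m. 0 < \<kappa> i" and sum: "(\<Sum>i\<le>m. \<kappa> i) < 1"
    define k where "k = nat \<lceil>real (m + 1) / (1 - (\<Sum>i\<le>m. \<kappa> i))\<rceil>"
    have "\<forall>\<^sub>F n in sequentially. k \<le> card (rcosets\<^bsub>G\<lparr>carrier := K n\<rparr>\<^esub> (H \<inter> K n))"
      using index_in_dense_chain_tendsto_infinity[OF assms(6) K compact assms(9) H op inf] .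
    then have "\<forall>\<^sub>F n in sequentially. ennreal \<delta> \<le> Sep (?X n) m \<kappa>"
    proof eventually_elim
      case (elim n)
      let ?G = "G\<lparr>carrier := K n\<rparr>"
      interpret Kn: topological_group ?G "subtopology T (K n)"
        using K by (rule topological_group_subgroup)
      show ?case
      proof (rule Kn.Sep_Haar_measure_lower_bound[where H = "H \<inter> K n"])
        show "mspace (submetric d (K n)) = carrier ?G" using KG assms(3) by auto
        show "right_invariant_metric ?G (submetric d (K n))"
          using assms(5) KG[of n] unfolding right_invariant_metric_def by (simp add: subset_iff)
        show "subgroup (H \<inter> K n) ?G"
          using H K by (intro subgroup_incl subgroups_Inter_pair) auto
        show "openin (subtopology T (K n)) (H \<inter> K n)" using op by (rule openin_subtopology_Int)
        have "real (m + 1) / (1 - (\<Sum>i\<le>m. \<kappa> i)) \<le> card (rcosets\<^bsub>?G\<^esub> (H \<inter> K n))"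
          using elim unfolding k_def by linarith
        then show "real (m + 1) \<le> (1 - (\<Sum>i\<le>m. \<kappa> i)) * card (rcosets\<^bsub>?G\<^esub> (H \<inter> K n))"
          using sum by (simp add: divide_le_eq mult.commute)
        show "x \<in> H \<inter> K n"
          if "x \<in> carrier ?G" "mdist (submetric d (K n)) x \<one>\<^bsub>?G\<^esub> < \<delta>" for x
          using that ball[of x] KG[of n] by auto
      qed (use Haar compactK pos in auto)
    qed
    then show "ennreal \<delta> \<le> liminf (\<lambda>n. Sep (?X n) m \<kappa>)" by (rule Liminf_bounded)
  qed
  then have diss: "dissipates ?X" using \<delta>(1) by (auto simp: dissipates_def)
  have "\<not> d_conc_Cauchy (\<lambda>n. ?X (r n))" if "strict_mono r" for r
    using mm dissipates_subseq[OF diss that] by (rule dissipates_not_d_conc_Cauchy)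
  then show ?thesis using mm diss by blast
qed

end
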